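(* Let $PR$ be the class of all finitely additive probabilities $\mu$ on the power set of $\mathbb{Z}$ such that $\mu(\{z\in\mathbb{Z}: z\equiv j \pmod p\})=1/p$ for every prime $p$ and every integer $j$. For every $r\in\mathbb{Z}$ and every positive integer $m$ that is neither $1$ nor a prime, $$\{\mu(r \bmod m):\mu\in PR\}=\left[0,\frac{1}{\max\{p \text{ prime}: p\mid m\}}\right].$$
   Context: A finitely additive probability (probability charge) on the power set of $\mathbb{Z}$ is a function $\mu:2^{\mathbb{Z}}\to[0,\infty)$ with $\mu(\mathbb{Z})=1$ and $\mu(A\cup B)=\mu(A)+\mu(B)$ for all disjoint $A,B\subseteq\mathbb{Z}$. For integers $r$ and $m\ge 1$, $r \bmod m$ denotes the residue class $\{z\in\mathbb{Z}: z\equiv r \pmod m\}$. *)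

theory Defs
  imports
    "HOL-Analysis.Analysis"
    "HOL-Number_Theory.Cong"
begin

definition finitely_additive_prob :: "(int set \<Rightarrow> real) \<Rightarrow> bool" where
  "finitely_additive_prob \<mu> \<longleftrightarrow>
     (\<forall>A. 0 \<le> \<mu> A) \<and> \<mu> UNIV = 1 \<and> additive (Pow UNIV) \<mu>"

definition residue_class :: "int \<Rightarrow> nat \<Rightarrow> int set" where
  "residue_class r m = {z. [z = r] (mod (int m))}"

definition PR :: "(int set \<Rightarrow> real) set" where
  "PR = {\<mu>. finitely_additive_prob \<mu> \<and>
     (\<forall>p :: nat. prime p \<longrightarrow> (\<forall>j :: int. \<mu> (residue_class j p) = 1 / real p))}"

end

theory Submission
  imports Defs
begin

text \<open>The upper bound is monotonicity: if \<open>p\<close> is the largest prime factor of \<open>m\<close>, then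
  \<open>r mod m\<close> is a subset of \<open>r mod p\<close>. For the converse, \<open>PR\<close> is convex, so it suffices that the values \<open>0\<close> and
  \<open>1 / p\<close> are attained.

  Membership in \<open>PR\<close> fixes the distribution of each residue modulo a prime but determines neither
  their joint distribution nor that of residues modulo higher powers. By the Chinese remainder
  theorem these can be chosen freely for the finitely many primes up to \<open>N\<close>, so that there are finitely
  supported probabilities on the integers with any prescribed coupling of the residues. All residues
  are taken here as functions of one uniform variable \<open>U\<close> in \<open>[0, 1)\<close>: the residue at \<open>q\<close> is
  \<open>r + s q + \<lfloor>q U\<rfloor>\<close>, where the translations \<open>s q\<close> are still free.

  With \<open>s = 0\<close> the residues agree with \<open>r\<close>, modulo powers of \<open>q\<close> as well, on the nested
  intervals \<open>U < 1 / q\<close>, hence simultaneously for all \<open>q\<close> dividing \<open>m\<close> exactly when \<open>U < 1 / p\<close>; this gives the value \<open>1 / p\<close> (\<open>PR_attains_max\<close>). The value \<open>0\<close>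
  uses that \<open>m\<close> is composite. Either some \<open>q\<^sup>2\<close> divides \<open>m\<close>, and \<open>r\<close> can be avoided modulo \<open>q\<^sup>2\<close>
  (\<open>PR_attains_0_square\<close>), or two distinct primes divide \<open>m\<close>, and a translation makes the two events of
  agreeing with \<open>r\<close> disjoint (\<open>PR_attains_0_two_primes\<close>).

  Finally \<open>N\<close> tends to infinity: compactness of the set of \<open>[0, 1]\<close>-valued set functions gives a
  cluster point, which is a charge in \<open>PR\<close> with the same value on \<open>r mod m\<close>
  (\<open>finitely_additive_prob_cluster_point\<close>).\<close>

section \<open>Limits of charges\<close>

lemma finitely_additive_probI:
  assumes "\<And>A. 0 \<le> \<mu> A" "\<mu> UNIV = 1" "\<And>A B. A \<inter> B = {} \<Longrightarrow> \<mu> (A \<union> B) = \<mu> A + \<mu> B"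
  shows "finitely_additive_prob \<mu>"
  using assms by (auto simp: finitely_additive_prob_def additive_def)

lemma finitely_additive_prob_Un:
  assumes "finitely_additive_prob \<mu>" "A \<inter> B = {}"
  shows "\<mu> (A \<union> B) = \<mu> A + \<mu> B"
  using assms by (auto simp: finitely_additive_prob_def additive_def)

lemma finitely_additive_prob_mono:
  assumes \<mu>: "finitely_additive_prob \<mu>" and "A \<subseteq> B"
  shows "\<mu> A \<le> \<mu> B"
proof -
  have "B = A \<union> (B - A)" using \<open>A \<subseteq> B\<close> by auto
  then have "\<mu> B = \<mu> A + \<mu> (B - A)"
    using finitely_additive_prob_Un[OF \<mu>, of A "B - A"] by auto
  then show ?thesis using \<mu> by (simp add: finitely_additive_prob_def)
qed

lemma finitely_additive_prob_le_1:
  "finitely_additive_prob \<mu> \<Longrightarrow> \<mu> A \<le> 1"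
  using finitely_additive_prob_mono[of \<mu> A UNIV] by (simp add: finitely_additive_prob_def)

text \<open>The set functions with values in \<open>[0, 1]\<close> form a compact set for the product topology, by Tychonoff's
  theorem, so the sequence has a cluster point there. Each closed condition that holds eventually
  along the sequence passes to the cluster point; prescribed values and additivity are conditions
  on finitely many coordinates, hence closed.\<close>

lemma finitely_additive_prob_cluster_point:
  fixes M :: "nat \<Rightarrow> int set \<Rightarrow> real"
  assumes M: "\<And>n. finitely_additive_prob (M n)"
  obtains \<mu> where "finitely_additive_prob \<mu>"
    "\<And>A c. \<forall>\<^sub>F n in sequentially. M n A = c \<Longrightarrow> \<mu> A = c"
proof -
  define C :: "(int set \<Rightarrow> real) set" where "C = PiE UNIV (\<lambda>_. {0..1})"
  define F where "F = filtermap M sequentially"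
  have "compact C"
    unfolding C_def compactin_euclidean_iff[symmetric] euclidean_product_topology[symmetric] compactin_PiE
    by simp
  moreover have "M n \<in> C" for n
    using M finitely_additive_prob_le_1[OF M] by (auto simp: C_def finitely_additive_prob_def)
  then have "eventually (\<lambda>f. f \<in> C) F" by (simp add: F_def eventually_filtermap)
  moreover have "F \<noteq> bot" by (simp add: F_def filtermap_bot_iff)
  ultimately obtain \<mu> where "\<mu> \<in> C" and cluster: "inf (nhds \<mu>) F \<noteq> bot"
    unfolding compact_filter by blast
  have closed_condition: "\<mu> \<in> S" if "closed S" "\<forall>\<^sub>F n in sequentially. M n \<in> S" for S
  proof (rule ccontr)
    assume "\<mu> \<notin> S"
    then have "eventually (\<lambda>f. f \<in> - S) (nhds \<mu>)"
      using \<open>closed S\<close> by (intro eventually_nhds_in_open) auto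
    moreover have "eventually (\<lambda>f. f \<in> S) F"
      using that(2) by (simp add: F_def eventually_filtermap)
    ultimately have "eventually (\<lambda>_. False) (inf (nhds \<mu>) F)"
      unfolding eventually_inf by force
    then show False using cluster by (simp add: eventually_False)
  qed
  have attained: "\<mu> A = c" if "\<forall>\<^sub>F n in sequentially. M n A = c" for A c
    using closed_condition[OF closed_Collect_eq, of "\<lambda>f. f A" "\<lambda>_. c"] that by simp
  have "\<mu> (A \<union> B) = \<mu> A + \<mu> B" if "A \<inter> B = {}" for A B
    using closed_condition[OF closed_Collect_eq, of "\<lambda>f. f (A \<union> B)" "\<lambda>f. f A + f B"]
      finitely_additive_prob_Un[OF M that]
    by (simp add: continuous_on_add)
  moreover have "0 \<le> \<mu> A" for A using \<open>\<mu> \<in> C\<close> by (auto simp: C_def)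
  moreover have "\<mu> UNIV = 1" using M by (intro attained) (simp add: finitely_additive_prob_def)
  ultimately have "finitely_additive_prob \<mu>" by (intro finitely_additive_probI)
  with attained show thesis by (rule that[rotated])
qed

lemma finitely_additive_prob_convex:
  assumes "finitely_additive_prob \<mu>" "finitely_additive_prob \<nu>" "0 \<le> t" "t \<le> 1"
  shows "finitely_additive_prob (\<lambda>A. (1 - t) * \<mu> A + t * \<nu> A)"
proof (rule finitely_additive_probI)
  fix A B :: "int set"
  assume "A \<inter> B = {}"
  then show "(1 - t) * \<mu> (A \<union> B) + t * \<nu> (A \<union> B)
      = (1 - t) * \<mu> A + t * \<nu> A + ((1 - t) * \<mu> B + t * \<nu> B)"
    using assms by (simp add: finitely_additive_prob_Un algebra_simps)
qed (use assms in \<open>auto simp: finitely_additive_prob_def\<close>)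

lemma PR_convex:
  assumes "\<mu> \<in> PR" "\<nu> \<in> PR" "0 \<le> t" "t \<le> 1"
  shows "(\<lambda>A. (1 - t) * \<mu> A + t * \<nu> A) \<in> PR"
  using assms finitely_additive_prob_convex[of \<mu> \<nu> t]
  by (auto simp: PR_def simp flip: add_divide_distrib)

section \<open>Coupling the residues of a uniform variable\<close>

definition empirical :: "nat \<Rightarrow> (nat \<Rightarrow> int) \<Rightarrow> int set \<Rightarrow> real" where
  "empirical n z A = real (card {u \<in> {..<n}. z u \<in> A}) / real n"

lemma finitely_additive_prob_empirical:
  assumes "n > 0"
  shows "finitely_additive_prob (empirical n z)"
proof (rule finitely_additive_probI)
  fix A B :: "int set"
  assume "A \<inter> B = {}"
  then have "card {u \<in> {..<n}. z u \<in> A \<union> B} = card {u \<in> {..<n}. z u \<in> A} + card {u \<in> {..<n}. z u \<in> B}"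
    by (subst card_Un_disjoint[symmetric]) (auto intro!: arg_cong[where f = card])
  then show "empirical n z (A \<union> B) = empirical n z A + empirical n z B"
    by (simp add: empirical_def add_divide_distrib)
qed (use assms in \<open>auto simp: empirical_def\<close>)

text \<open>A uniform \<open>u < q * d\<close> has uniform leading digit \<open>u div d < q\<close>, and translating a uniform residue
  leaves it uniform.\<close>

lemma empirical_residue_class:
  fixes a :: int
  assumes "q > 0" "d > 0" and z: "\<And>u. u < q * d \<Longrightarrow> [z u = a + int (u div d)] (mod int q)"
  shows "empirical (q * d) z (residue_class j q) = 1 / real q"
proof -
  define b where "b = nat ((j - a) mod int q)"
  have b: "int b = (j - a) mod int q" "b < q" using \<open>q > 0\<close> by (auto simp: b_def nat_less_iff)
  have "z u \<in> residue_class j q \<longleftrightarrow> u div d = b" if "u < q * d" for u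
  proof -
    have less: "u div d < q" using that \<open>d > 0\<close> by (simp add: less_mult_imp_div_less)
    have "z u \<in> residue_class j q \<longleftrightarrow> [a + int (u div d) = j] (mod int q)"
      using z[OF that] by (simp only: residue_class_def cong_def mem_Collect_eq)
    also have "\<dots> \<longleftrightarrow> [int (u div d) = j - a] (mod int q)"
      by (simp add: cong_iff_dvd_diff algebra_simps)
    also have "\<dots> \<longleftrightarrow> int (u div d) = int b"
    proof -
      have "int (u div d) mod int q = int (u div d)"
        using less by (intro mod_pos_pos_trivial) (simp_all only: of_nat_less_iff of_nat_0_le_iff)
      then show ?thesis by (simp only: cong_def b(1))
    qed
    finally show ?thesis by (simp only: of_nat_eq_iff)
  qed
  then have "{u \<in> {..<q * d}. z u \<in> residue_class j q} = {u \<in> {..<q * d}. u div d = b}" by auto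
  also have "\<dots> = {b * d..<Suc b * d}"
  proof -
    have "Suc b * d \<le> q * d" using b(2) by (intro mult_le_mono1) simp
    moreover have "u div d = b \<longleftrightarrow> b * d \<le> u \<and> u < Suc b * d" for u
      using div_less_iff_less_mult[OF \<open>d > 0\<close>, of u "Suc b"] less_eq_div_iff_mult_less_eq[OF \<open>d > 0\<close>, of b u]
      by linarith
    ultimately show ?thesis by (intro set_eqI) (simp; linarith)
  qed
  finally show ?thesis using assms by (simp add: empirical_def)
qed

definition primorial :: "nat \<Rightarrow> nat" where
  "primorial N = \<Prod>{q. prime q \<and> q \<le> N}"

lemma primorial_pos: "primorial N > 0"
  by (auto simp: primorial_def prime_gt_0_nat intro!: prod_pos)

lemma dvd_primorial: "prime q \<Longrightarrow> q \<le> N \<Longrightarrow> q dvd primorial N"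
  unfolding primorial_def by (rule dvd_prodI[of _ _ "\<lambda>x. x", simplified]) auto

text \<open>The number \<open>u div (primorial N div q)\<close> is \<open>\<lfloor>q U\<rfloor>\<close> for \<open>U = u / primorial N\<close>, the first digit of \<open>U\<close> in
  base \<open>q\<close>. The congruence is imposed modulo \<open>q ^ k\<close> in order to control the residue modulo \<open>m\<close> when
  \<open>m\<close> has repeated prime factors.\<close>

definition coupled :: "int \<Rightarrow> (nat \<Rightarrow> nat) \<Rightarrow> nat \<Rightarrow> nat \<Rightarrow> nat \<Rightarrow> int \<Rightarrow> bool" where
  "coupled r s k N u z \<longleftrightarrow>
     (\<forall>q. prime q \<and> q \<le> N \<longrightarrow> [z = r + int (s q + u div (primorial N div q))] (mod int (q ^ k)))"

lemma ex_coupled: "\<exists>z. coupled r s k N u z"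
proof -
  have "\<exists>x. \<forall>q\<in>{q. prime q \<and> q \<le> N}. [x = s q + u div (primorial N div q)] (mod q ^ k)"
    by (rule chinese_remainder_nat) (auto simp: primes_coprime)
  then obtain x where x:
    "\<And>q. prime q \<Longrightarrow> q \<le> N \<Longrightarrow> [x = s q + u div (primorial N div q)] (mod q ^ k)"
    by auto
  have "coupled r s k N u (r + int x)"
    unfolding coupled_def using x by (auto simp only: cong_add_lcancel cong_int_iff)
  then show ?thesis ..
qed

text \<open>For large \<open>N\<close>, the coupled points give a finitely supported probability that is uniform modulo
  every prime up to \<open>N\<close> and gives \<open>A\<close> the proportion \<open>c\<close> of favourable \<open>u\<close>; a cluster point as
  \<open>N \<rightarrow> \<infinity>\<close> has all these values at once.\<close>

lemma PR_from_coupling: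
  assumes "k > 0"
    and favourable: "\<And>N u z. N\<^sub>0 \<le> N \<Longrightarrow> u < primorial N \<Longrightarrow> coupled r s k N u z \<Longrightarrow> z \<in> A \<longleftrightarrow> u \<in> B N"
    and card: "\<And>N. N\<^sub>0 \<le> N \<Longrightarrow> real (card ({..<primorial N} \<inter> B N)) = c * real (primorial N)"
  shows "\<exists>\<mu>\<in>PR. \<mu> A = c"
proof -
  define Z where "Z N u = (SOME z. coupled r s k N u z)" for N u
  have Z: "coupled r s k N u (Z N u)" for N u
    unfolding Z_def by (rule someI_ex) (rule ex_coupled)
  define M where "M N = empirical (primorial N) (Z N)" for N
  have M: "finitely_additive_prob (M N)" for N
    unfolding M_def by (rule finitely_additive_prob_empirical) (rule primorial_pos)
  obtain \<mu> where \<mu>: "finitely_additive_prob \<mu>"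
    "\<And>A c. \<forall>\<^sub>F n in sequentially. M n A = c \<Longrightarrow> \<mu> A = c"
    using finitely_additive_prob_cluster_point[of M, OF M] by blast
  have uniform: "M N (residue_class j q) = 1 / real q" if "prime q" "q \<le> N" for N q j
  proof -
    define d where "d = primorial N div q"
    have Q: "primorial N = q * d" using dvd_primorial[OF that] by (simp add: d_def)
    have "d > 0" using primorial_pos[of N] by (simp add: Q)
    have "[Z N u = r + int (s q) + int (u div d)] (mod int q)" for u
    proof (rule cong_dvd_modulus)
      show "[Z N u = r + int (s q) + int (u div d)] (mod int (q ^ k))"
        using Z[of N u] that by (simp add: coupled_def d_def add.assoc)
      show "int q dvd int (q ^ k)" using \<open>k > 0\<close> by (simp add: dvd_power)
    qed
    then show ?thesis
      unfolding M_def Q using \<open>d > 0\<close> prime_gt_0_nat[OF \<open>prime q\<close>]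
      by (intro empirical_residue_class)
  qed
  have "\<mu> (residue_class j q) = 1 / real q" if "prime q" for q j
    using uniform[OF that] by (intro \<mu>(2) eventually_sequentiallyI[of q]) auto
  then have "\<mu> \<in> PR" using \<mu>(1) by (simp add: PR_def)
  moreover have "M N A = c" if "N\<^sub>0 \<le> N" for N
  proof -
    have "{u \<in> {..<primorial N}. Z N u \<in> A} = {..<primorial N} \<inter> B N"
      using favourable[OF that _ Z] by auto
    then show ?thesis
      using card[OF that] primorial_pos[of N] by (simp add: M_def empirical_def)
  qed
  then have "\<mu> A = c" by (intro \<mu>(2) eventually_sequentiallyI[of N\<^sub>0])
  ultimately show ?thesis by blast
qed

section \<open>The extreme values\<close>

text \<open>The exponent \<open>m\<close> is a crude bound for the multiplicity of any prime in \<open>m\<close>; it lets one exponent serve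
  all primes.\<close>

lemma dvd_if_prime_powers_dvd:
  fixes m x :: nat
  assumes "m > 0" and "\<And>q. prime q \<Longrightarrow> q dvd m \<Longrightarrow> q ^ m dvd x"
  shows "m dvd x"
proof (cases "x = 0")
  case False
  show ?thesis
  proof (rule multiplicity_le_imp_dvd)
    fix q :: nat
    assume "prime q"
    show "multiplicity q m \<le> multiplicity q x"
    proof (cases "q dvd m")
      case True
      have "multiplicity q m < q ^ multiplicity q m"
        using prime_gt_1_nat[OF \<open>prime q\<close>] by (simp add: power_gt_expt)
      also have "\<dots> \<le> m" using \<open>m > 0\<close> by (intro dvd_imp_le multiplicity_dvd)
      also have "m \<le> multiplicity q x"
        using assms(2)[OF \<open>prime q\<close> True] False \<open>prime q\<close> by (intro multiplicity_geI) auto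
      finally show ?thesis by simp
    qed (simp add: not_dvd_imp_multiplicity_0)
  qed (use \<open>m > 0\<close> in simp)
qed simp

lemma coupled_dvd:
  assumes "coupled r s k N u z" "prime q" "q \<le> N" "q ^ i dvd m" "i \<le> k"
    and "z \<in> residue_class r m"
  shows "q ^ i dvd s q + u div (primorial N div q)"
proof -
  have "[z = r] (mod int (q ^ i))"
  proof (rule cong_dvd_modulus)
    show "[z = r] (mod int m)" using assms by (simp add: residue_class_def)
    show "int (q ^ i) dvd int m" using assms by (simp only: of_nat_dvd_iff)
  qed
  moreover have "[z = r + int (s q + u div (primorial N div q))] (mod int (q ^ i))"
  proof (rule cong_dvd_modulus)
    show "[z = r + int (s q + u div (primorial N div q))] (mod int (q ^ k))"
      using assms by (simp only: coupled_def)
    show "int (q ^ i) dvd int (q ^ k)" using assms by (simp only: of_nat_dvd_iff le_imp_power_dvd)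
  qed
  ultimately have "[r + int (s q + u div (primorial N div q)) = r + 0] (mod int (q ^ i))"
    by (metis add.right_neutral cong_sym cong_trans)
  then show ?thesis
    by (simp only: cong_add_lcancel cong_0_iff of_nat_dvd_iff)
qed

lemma digit_less:
  assumes "prime q" "q \<le> N" "u < primorial N"
  shows "u div (primorial N div q) < q"
  using assms dvd_primorial[of q N] by (metis dvd_mult_div_cancel less_mult_imp_div_less)

lemma prime_dvd_digit:
  assumes "prime q" "q \<le> N" "u < primorial N"
  shows "q dvd u div (primorial N div q) \<longleftrightarrow> u < primorial N div q"
proof -
  have "primorial N div q > 0"
    using dvd_primorial[OF assms(1,2)] primorial_pos[of N] by (auto elim!: dvdE)
  then have "u div (primorial N div q) = 0 \<longleftrightarrow> u < primorial N div q"
    by (metis div_eq_0_iff less_irrefl)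
  moreover have "q dvd u div (primorial N div q) \<longleftrightarrow> u div (primorial N div q) = 0"
    using digit_less[OF assms] nat_dvd_not_less by (metis dvd_0_right gr0I)
  ultimately show ?thesis by simp
qed

text \<open>With no translation, the events "first digit \<open>0\<close>" are nested intervals, the smallest belonging to
  the largest prime. So \<open>z \<equiv> r\<close> modulo the largest prime factor already forces \<open>z \<equiv> r\<close> modulo \<open>m\<close>.\<close>

lemma PR_attains_max:
  assumes "m > 0" "prime p" "p dvd m" and largest: "\<And>q. prime q \<Longrightarrow> q dvd m \<Longrightarrow> q \<le> p"
  shows "\<exists>\<mu>\<in>PR. \<mu> (residue_class r m) = 1 / real p"
proof (rule PR_from_coupling[of m m r "\<lambda>_. 0" _ "\<lambda>N. {..<primorial N div p}"])
  fix N assume "m \<le> N"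
  have le_N: "q \<le> N" if "q dvd m" for q
    using dvd_imp_le[OF that \<open>m > 0\<close>] \<open>m \<le> N\<close> by simp
  have "p dvd primorial N" using \<open>prime p\<close> le_N[OF \<open>p dvd m\<close>] by (rule dvd_primorial)
  moreover have "{..<primorial N} \<inter> {..<primorial N div p} = {..<primorial N div p}"
    using div_le_dividend[of "primorial N" p] by (auto intro: less_le_trans)
  ultimately show "real (card ({..<primorial N} \<inter> {..<primorial N div p})) = 1 / real p * real (primorial N)"
    by (simp add: real_of_nat_div)
  fix u z assume u: "u < primorial N" and z: "coupled r (\<lambda>_. 0) m N u z"
  show "z \<in> residue_class r m \<longleftrightarrow> u \<in> {..<primorial N div p}"
  proof
    assume "z \<in> residue_class r m"
    then have "p ^ 1 dvd 0 + u div (primorial N div p)"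
      using z assms le_N by (intro coupled_dvd[OF z]) auto
    then show "u \<in> {..<primorial N div p}"
      using prime_dvd_digit[OF \<open>prime p\<close> le_N[OF \<open>p dvd m\<close>] u] by simp
  next
    assume "u \<in> {..<primorial N div p}"
    have zero: "[z = r] (mod int (q ^ m))" if q: "prime q" "q dvd m" for q
    proof -
      have "primorial N div p \<le> primorial N div q"
        using largest[OF q] prime_gt_0_nat[OF q(1)] by (intro div_le_mono2)
      with \<open>u \<in> {..<primorial N div p}\<close> have "u div (primorial N div q) = 0" by simp
      then show ?thesis using z q le_N by (auto simp: coupled_def)
    qed
    have "m dvd nat \<bar>z - r\<bar>"
    proof (rule dvd_if_prime_powers_dvd[OF \<open>m > 0\<close>])
      fix q assume "prime q" "q dvd m"
      from zero[OF this] show "q ^ m dvd nat \<bar>z - r\<bar>"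
        by (simp only: cong_iff_dvd_diff dvd_nat_abs_iff)
    qed
    then show "z \<in> residue_class r m"
      by (simp add: residue_class_def cong_iff_dvd_diff dvd_nat_abs_iff)
  qed
qed (use \<open>m > 0\<close> in simp)

lemma PR_attains_0_if_avoidable:
  assumes "m > 0"
    and avoids: "\<And>N u z. m \<le> N \<Longrightarrow> u < primorial N \<Longrightarrow> coupled r s m N u z \<Longrightarrow> z \<notin> residue_class r m"
  shows "\<exists>\<mu>\<in>PR. \<mu> (residue_class r m) = 0"
  using assms by (intro PR_from_coupling[of m m r s _ "\<lambda>_. {}"]) auto

text \<open>Being congruent to \<open>r\<close> modulo \<open>q\<close> leaves the residue modulo \<open>q\<^sup>2\<close> free: translating by \<open>q\<close>
  keeps the distribution modulo \<open>q\<close> and misses \<open>r\<close> modulo \<open>q\<^sup>2\<close>.\<close>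

lemma PR_attains_0_square:
  assumes "m > 0" "prime q" "q ^ 2 dvd m"
  shows "\<exists>\<mu>\<in>PR. \<mu> (residue_class r m) = 0"
proof (rule PR_attains_0_if_avoidable[OF \<open>m > 0\<close>, of r "\<lambda>_. q"])
  fix N u z
  assume N: "m \<le> N" and u: "u < primorial N" and z: "coupled r (\<lambda>_. q) m N u z"
  define x where "x = u div (primorial N div q)"
  have "q ^ 2 \<le> m" using dvd_imp_le assms by blast
  moreover have "2 \<le> q" "q < q ^ 2"
    using prime_ge_2_nat[OF \<open>prime q\<close>] by (auto simp: power2_eq_square)
  ultimately have "2 \<le> m" "q \<le> N" using N by linarith+
  have "x < q" unfolding x_def by (rule digit_less) fact+
  show "z \<notin> residue_class r m"
  proof
    assume "z \<in> residue_class r m"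
    then have "q ^ 2 dvd q + x"
      unfolding x_def using assms \<open>2 \<le> m\<close> \<open>q \<le> N\<close> by (intro coupled_dvd[OF z]) auto
    then have "q ^ 2 \<le> q + x" using \<open>2 \<le> q\<close> by (intro dvd_imp_le) auto
    also have "\<dots> < 2 * q" using \<open>x < q\<close> by simp
    also have "\<dots> \<le> q ^ 2" using \<open>2 \<le> q\<close> by (simp add: power2_eq_square)
    finally show False by simp
  qed
qed

text \<open>Translating by \<open>1\<close> at \<open>q\<close> only, \<open>z \<equiv> r\<close> modulo \<open>p\<close> needs \<open>u\<close> in the first \<open>p\<close>-th of the range and
  \<open>z \<equiv> r\<close> modulo \<open>q\<close> needs \<open>u\<close> in the last \<open>q\<close>-th. These are disjoint because \<open>1/p + 1/q \<le> 1\<close>.\<close>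

lemma PR_attains_0_two_primes:
  assumes "m > 0" "prime p" "prime q" "p \<noteq> q" "p dvd m" "q dvd m"
  shows "\<exists>\<mu>\<in>PR. \<mu> (residue_class r m) = 0"
proof (rule PR_attains_0_if_avoidable[OF \<open>m > 0\<close>, of r "\<lambda>i. if i = q then 1 else 0"])
  fix N u z
  assume N: "m \<le> N" and u: "u < primorial N"
    and z: "coupled r (\<lambda>i. if i = q then 1 else 0) m N u z"
  have le_N: "p \<le> N" "q \<le> N" using dvd_imp_le assms N by (meson le_trans)+
  show "z \<notin> residue_class r m"
  proof
    assume r: "z \<in> residue_class r m"
    define d where "d = primorial N div q"
    have Q: "primorial N = q * d"
      using dvd_primorial[OF \<open>prime q\<close> \<open>q \<le> N\<close>] by (simp add: d_def)
    have "p ^ 1 dvd (if p = q then 1 else 0) + u div (primorial N div p)"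
      using assms le_N r by (intro coupled_dvd[OF z]) auto
    then have "u < primorial N div p"
      using prime_dvd_digit[OF \<open>prime p\<close> \<open>p \<le> N\<close> u] \<open>p \<noteq> q\<close> by simp
    also have "\<dots> \<le> primorial N div 2"
      using prime_ge_2_nat[OF \<open>prime p\<close>] by (intro div_le_mono2) auto
    finally have upper: "2 * u < q * d" using Q by linarith
    have "q ^ 1 dvd (if q = q then 1 else 0) + u div (primorial N div q)"
      using assms le_N r by (intro coupled_dvd[OF z]) auto
    then have "q \<le> 1 + u div d" unfolding d_def by (intro dvd_imp_le) auto
    then have "q * d \<le> (1 + u div d) * d" by (intro mult_le_mono1)
    also have "\<dots> \<le> d + u" by (simp add: algebra_simps)
    finally have lower: "q * d \<le> d + u" .
    have "2 * d \<le> q * d" using prime_ge_2_nat[OF \<open>prime q\<close>] by (intro mult_le_mono1)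
    with upper lower show False by linarith
  qed
qed

lemma PR_attains_0:
  assumes "m > 0" "m \<noteq> 1" "\<not> prime m"
  shows "\<exists>\<mu>\<in>PR. \<mu> (residue_class r m) = 0"
proof -
  obtain p where p: "prime p" "p dvd m" using \<open>m \<noteq> 1\<close> prime_factor_nat by blast
  then obtain n where n: "m = p * n" by blast
  with p assms have "n \<noteq> 1" by auto
  then obtain q where q: "prime q" "q dvd n" using prime_factor_nat by blast
  show ?thesis
  proof (cases "p = q")
    case True
    then have "p ^ 2 dvd m" using q n by (simp add: power2_eq_square)
    with \<open>m > 0\<close> \<open>prime p\<close> show ?thesis by (rule PR_attains_0_square)
  next
    case False
    then show ?thesis using p q n \<open>m > 0\<close> by (intro PR_attains_0_two_primes[of m p q]) auto
  qed
qed

section \<open>The range of values\<close>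

theorem theorem5:
  fixes r :: int and m :: nat
  assumes "m > 0" and "m \<noteq> 1" and "\<not> prime m"
  shows "{\<mu> (residue_class r m) | \<mu>. \<mu> \<in> PR} = {0 .. 1 / real (Max {p. prime p \<and> p dvd m})}"
proof -
  define p where "p = Max {p. prime p \<and> p dvd m}"
  have finite: "finite {p. prime p \<and> p dvd m}"
    using \<open>m > 0\<close> by (auto intro: finite_subset[of _ "{..m}"] dest: dvd_imp_le)
  moreover have "{p. prime p \<and> p dvd m} \<noteq> {}"
    using \<open>m \<noteq> 1\<close> prime_factor_nat by auto
  ultimately have p: "prime p" "p dvd m"
    using Max_in unfolding p_def by blast+
  have largest: "q \<le> p" if "prime q" "q dvd m" for q
    unfolding p_def using finite that by (intro Max_ge) auto
  have "0 \<le> \<mu> (residue_class r m) \<and> \<mu> (residue_class r m) \<le> 1 / real p" if "\<mu> \<in> PR" for \<mu>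
  proof -
    have charge: "finitely_additive_prob \<mu>" using that by (simp add: PR_def)
    have "residue_class r m \<subseteq> residue_class r p"
      using \<open>p dvd m\<close> by (auto simp: residue_class_def intro: cong_dvd_modulus)
    from finitely_additive_prob_mono[OF charge this] that p charge show ?thesis
      by (auto simp: PR_def finitely_additive_prob_def)
  qed
  moreover have "\<exists>\<mu>\<in>PR. \<mu> (residue_class r m) = x" if x: "0 \<le> x" "x \<le> 1 / real p" for x
  proof -
    obtain \<mu> where \<mu>: "\<mu> \<in> PR" "\<mu> (residue_class r m) = 0"
      using PR_attains_0[OF assms] by blast
    obtain \<nu> where \<nu>: "\<nu> \<in> PR" "\<nu> (residue_class r m) = 1 / real p"
      using PR_attains_max[OF \<open>m > 0\<close> p largest] by blast
    have "real p > 0" using p prime_gt_0_nat by simp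
    then have "x * real p \<le> 1" "0 \<le> x * real p" using x by (auto simp: field_simps)
    from PR_convex[OF \<mu>(1) \<nu>(1) this(2,1)] show ?thesis
      by (rule rev_bexI) (use \<mu> \<nu> \<open>real p > 0\<close> in simp)
  qed
  ultimately show ?thesis unfolding p_def[symmetric] by fastforce
qed

end
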